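(* Let $\mathcal{B}$ be a homothecy invariant density basis consisting of open sets in $\mathbb{R}^{n}$, and let $\phi$ be the halo function associated to $\mathcal{B}$, defined on $(1,\infty)$ by $$\phi(u) = \sup \left\{\frac{1}{|A|}\left|\left\{x \in \mathbb{R}^{n} : M_{\mathcal{B}}\chi_{A}(x) > \frac{1}{u}\right\}\right| : A \subset \mathbb{R}^n \text{ measurable},\ 0 < |A| < \infty\right\}.$$ Then $\phi$ is a continuous function on $(1,\infty)$.
   Context: $|\cdot|$ denotes Lebesgue measure on $\mathbb{R}^n$ and $\chi_A$ the characteristic function of $A$. A collection $\mathcal{B}$ of sets is homothecy invariant if for every $R\in\mathcal{B}$, $r>0$ and $a\in\mathbb{R}^n$, the set $a+rR$ also belongs to $\mathcal{B}$. A collection $\mathcal{B}$ of open sets in $\mathbb{R}^n$ such that every $x\in\mathbb{R}^n$ is contained in members of $\mathcal{B}$ of arbitrarily small diameter is called a density basis if, for every measurable $A\subset\mathbb{R}^n$, for almost every $x\in\mathbb{R}^n$ one has $\lim_{k\to\infty}\frac{1}{|R_k|}\int_{R_k}\chi_A=\chi_A(x)$ for every sequence $\{R_k\}$ of members of $\mathcal{B}$ containing $x$ whose diameters tend to $0$. The geometric maximal operator associated to $\mathcal{B}$ is $M_{\mathcal{B}}f(x)=\sup_{x\in R\in\mathcal{B}}\frac{1}{|R|}\int_R|f|$. The supremum defining $\phi(u)$ is a priori taken in $[0,\infty]$. *)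

theory Defs
  imports "HOL-Analysis.Analysis"
begin

definition homothecy_invariant :: "(real^'n) set set \<Rightarrow> bool" where
  "homothecy_invariant B \<longleftrightarrow>
     (\<forall>R\<in>B. \<forall>r>0. \<forall>a. (\<lambda>x. a + r *\<^sub>R x) ` R \<in> B)"

(* If R has infinite measure, division in ennreal makes the average 0 = 1/\<infinity> * c for every finite
   integral c. Members of a basis containing a given point are open and nonempty, so the
   denominator is never 0 there. *)

definition average :: "(real^'n) set \<Rightarrow> (real^'n \<Rightarrow> ennreal) \<Rightarrow> ennreal" where
  "average R f = (\<integral>\<^sup>+y\<in>R. f y \<partial>lebesgue) / emeasure lebesgue R"

(* Members of a basis are not assumed bounded. The library's diameter is meaningful only for
   bounded sets, so boundedness accompanies each condition on diameters; this is what
   finiteness (resp. convergence to 0) of the diameter in [0,\<infinity>] says. *)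

definition density_basis :: "(real^'n) set set \<Rightarrow> bool" where
  "density_basis B \<longleftrightarrow>
     (\<forall>R\<in>B. open R) \<and>
     (\<forall>x. \<forall>\<epsilon>>0. \<exists>R\<in>B. x \<in> R \<and> bounded R \<and> diameter R < \<epsilon>) \<and>
     (\<forall>A\<in>sets lebesgue. AE x in lebesgue. \<forall>R :: nat \<Rightarrow> (real^'n) set.
        (\<forall>k. R k \<in> B \<and> x \<in> R k) \<longrightarrow>
        (\<forall>\<^sub>F k in sequentially. bounded (R k)) \<longrightarrow>
        (\<lambda>k. diameter (R k)) \<longlonglongrightarrow> 0 \<longrightarrow>
        (\<lambda>k. average (R k) (indicator A)) \<longlonglongrightarrow> indicator A x)"

definition maximal_operator ::
  "(real^'n) set set \<Rightarrow> (real^'n \<Rightarrow> real) \<Rightarrow> real^'n \<Rightarrow> ennreal" where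
  "maximal_operator B f x = (SUP R\<in>{R\<in>B. x \<in> R}. average R (\<lambda>y. ennreal \<bar>f y\<bar>))"

definition halo :: "(real^'n) set set \<Rightarrow> real \<Rightarrow> ennreal" where
  "halo B u =
     (SUP A\<in>{A \<in> sets lebesgue. 0 < emeasure lebesgue A \<and> emeasure lebesgue A < \<infinity>}.
        emeasure lebesgue {x. maximal_operator B (indicator A) x > ennreal (1 / u)}
          / emeasure lebesgue A)"

end

theory Submission
  imports Defs "HOL-Probability.Distribution_Functions"
begin

text \<open>If \<open>A\<close> has average above \<open>1/v\<close> over finitely many members \<open>R\<close> of the basis with union \<open>U\<close>,
  choose \<open>E \<subseteq> U - A\<close> that fills exactly the fraction \<open>\<delta>\<close> of every \<open>R - A\<close>, which is possible since
  Lebesgue measure has no atoms. Then \<open>A \<union> E\<close> has average above \<open>\<delta> + (1 - \<delta>)/v = 1/u\<close> over every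
  \<open>R\<close>, whence \<open>\<phi>(u) \<ge> |U| / (|A| + \<delta> |U|)\<close>, that is, \<open>1/\<phi>(u) \<le> 1/\<phi>(v) + \<delta>\<close>. Letting \<open>v\<close> decrease
  to \<open>u\<close> makes \<open>\<delta>\<close> tend to \<open>0\<close>, so the monotone function \<open>\<phi>\<close> is continuous from the right;
  continuity from the left is immediate because finitely many \<open>R\<close> suffice. For bounded \<open>R\<close>,
  \<open>\<phi>(u) = \<infinity>\<close> would give, by scaling and covering, sets of summable measure whose averages
  exceed \<open>1/u\<close> at ever smaller scales around most points of the unit ball; their union then
  violates the density property.\<close>

section \<open>Subsets filling a prescribed fraction of a set\<close>

text \<open>Spheres are null, so the measure of \<open>W \<inter> cball 0 r\<close> depends
  continuously on \<open>r\<close>, and the intermediate value theorem finds a radius at which it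
  equals the fraction \<delta> of the whole.\<close>

lemma lmeasurable_subset_proportion:
  fixes W :: "'a::euclidean_space set"
  assumes W: "W \<in> lmeasurable" and \<delta>: "0 < \<delta>" "\<delta> < 1"
  obtains E where "E \<in> lmeasurable" "E \<subseteq> W" "measure lebesgue E = \<delta> * measure lebesgue W"
proof (cases "measure lebesgue W = 0")
  case True
  with W that show ?thesis
    by auto
next
  case False
  \<comment> \<open>\<open>M\<close> is the image under the norm of Lebesgue measure on
    \<open>W\<close>. Its \<open>cdf\<close> at \<open>r\<close> is the measure of
    \<open>W \<inter> cball 0 r\<close>, and it is continuous wherever \<open>M\<close> has no
    atom.\<close>
  define M where "M = distr (restrict_space lebesgue W) borel (norm :: 'a \<Rightarrow> real)"
  have nW: "norm \<in> measurable (restrict_space lebesgue W) borel"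
    by (intro measurable_restrict_space1 measurable_completion) simp
  have Ws: "W \<in> sets lebesgue"
    using W by auto
  have M: "measure M S = measure lebesgue (norm -` S \<inter> W)" if "S \<in> sets borel" for S
    unfolding M_def measure_distr[OF nW that]
    using Ws by (subst measure_restrict_space) (auto simp: space_restrict_space)
  interpret finite_measure "restrict_space lebesgue W"
    using W Ws by (intro finite_measureI)
      (auto simp: emeasure_restrict_space space_restrict_space fmeasurable_def top_unique less_top)
  interpret M: finite_borel_measure M
    by (intro finite_borel_measure.intro finite_borel_measure_axioms.intro)
      (auto simp: M_def nW finite_measure_distr)
  have space: "space M = UNIV"
    by (simp add: M_def)
  have total: "measure M (space M) = measure lebesgue W"
    using M[of UNIV] by (simp add: space)
  have "measure M {r} = 0" for r
  proof -
    have "norm -` {r} \<inter> W \<subseteq> sphere 0 r"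
      by auto
    then have "negligible (norm -` {r} \<inter> W)"
      using negligible_sphere negligible_subset by blast
    then show ?thesis
      by (simp add: M negligible_imp_measure0)
  qed
  then have cont: "isCont (cdf M) r" for r
    by (simp add: M.isCont_cdf)
  have pos: "0 < measure lebesgue W"
    using False by (simp add: zero_less_measure_iff)
  then have "\<forall>\<^sub>F r in at_top. \<delta> * measure lebesgue W < cdf M r"
    using M.cdf_lim_at_top \<delta> unfolding total
    by (intro order_tendstoD(1)[of _ "measure lebesgue W"]) auto
  then have "\<forall>\<^sub>F r in at_top. 0 < r \<and> \<delta> * measure lebesgue W < cdf M r"
    using eventually_gt_at_top by (rule eventually_conj[rotated])
  then obtain b where b: "b > 0" "\<delta> * measure lebesgue W < cdf M b"
    using eventually_happens'[OF trivial_limit_at_top_linorder] by blast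
  \<comment> \<open>No point has negative norm, so \<open>- 1\<close> serves as a left endpoint at
    which the distribution function vanishes.\<close>
  have "norm -` {..- 1} \<inter> W = {}"
    using norm_ge_zero by (auto simp: not_le) (smt (verit) norm_ge_zero)
  then have "cdf M (- 1) = 0"
    by (simp add: cdf_def M)
  then obtain r where r: "cdf M r = \<delta> * measure lebesgue W"
    using IVT'[of "cdf M" "- 1" "\<delta> * measure lebesgue W" b] b pos \<delta> cont
    by (auto intro: continuous_at_imp_continuous_on)
  have "norm -` {..r} \<inter> W = cball 0 r \<inter> W"
    by auto
  moreover have "cball 0 r \<inter> W \<in> lmeasurable"
    using W by (intro fmeasurable_Int_fmeasurable) auto
  ultimately show ?thesis
    using that[of "cball 0 r \<inter> W"] r by (auto simp: cdf_def M)
qed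

text \<open>Induction on \<open>F\<close> with \<open>W\<close> arbitrary: a new member
  \<open>R\<close> splits \<open>W\<close> into \<open>W \<inter> R\<close> and
  \<open>W - R\<close>, and the induction hypothesis applies to each piece. The union of the two
  chosen sets keeps the proportions for the old members by additivity, and it has the right one for
  \<open>R\<close> since its trace on \<open>R\<close> is the set chosen in the first piece.\<close>

lemma lmeasurable_subset_proportion_family:
  fixes W :: "'a::euclidean_space set"
  assumes "finite F" "F \<subseteq> lmeasurable" "W \<in> lmeasurable" and \<delta>: "0 < \<delta>" "\<delta> < 1"
  shows "\<exists>E\<in>lmeasurable. E \<subseteq> W \<and> measure lebesgue E = \<delta> * measure lebesgue W \<and>
           (\<forall>R\<in>F. measure lebesgue (E \<inter> R) = \<delta> * measure lebesgue (W \<inter> R))"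
  using assms(1-3)
proof (induction F arbitrary: W rule: finite_induct)
  case empty
  then show ?case
    using lmeasurable_subset_proportion[OF _ \<delta>] by (metis empty_iff)
next
  case (insert R F)
  have lm: "W \<inter> R \<in> lmeasurable" "W - R \<in> lmeasurable"
    using insert.prems by (auto intro: fmeasurable.Int fmeasurable.Diff)
  obtain E1 where E1: "E1 \<in> lmeasurable" "E1 \<subseteq> W \<inter> R"
      "measure lebesgue E1 = \<delta> * measure lebesgue (W \<inter> R)"
      "\<forall>S\<in>F. measure lebesgue (E1 \<inter> S) = \<delta> * measure lebesgue (W \<inter> R \<inter> S)"
    using insert.IH[OF _ lm(1)] insert.prems by auto
  obtain E2 where E2: "E2 \<in> lmeasurable" "E2 \<subseteq> W - R"
      "measure lebesgue E2 = \<delta> * measure lebesgue (W - R)"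
      "\<forall>S\<in>F. measure lebesgue (E2 \<inter> S) = \<delta> * measure lebesgue ((W - R) \<inter> S)"
    using insert.IH[OF _ lm(2)] insert.prems by auto
  have split: "measure lebesgue X = measure lebesgue (X \<inter> R) + measure lebesgue (X - R)"
    if "X \<in> lmeasurable" for X
  proof -
    have "(X \<inter> R) \<union> (X - R) = X" "(X \<inter> R) \<inter> (X - R) = {}"
      by auto
    then show ?thesis
      using measure_Un3[of "X \<inter> R" lebesgue "X - R"] that insert.prems
      by (simp add: fmeasurable.Int fmeasurable.Diff)
  qed
  have E: "(E1 \<union> E2) \<inter> R = E1" "(E1 \<union> E2) - R = E2"
    using E1(2) E2(2) by auto
  have "E1 \<union> E2 \<in> lmeasurable" "E1 \<union> E2 \<subseteq> W"
    using E1(1,2) E2(1,2) by auto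
  moreover have "measure lebesgue (E1 \<union> E2) = \<delta> * measure lebesgue W"
    using split[OF \<open>E1 \<union> E2 \<in> lmeasurable\<close>] split[of W] E1 E2 insert.prems
    unfolding E by (simp add: algebra_simps)
  moreover have "measure lebesgue ((E1 \<union> E2) \<inter> S) = \<delta> * measure lebesgue (W \<inter> S)" if "S \<in> F" for S
  proof -
    have S: "S \<in> lmeasurable"
      using that insert.prems by auto
    have *: "(E1 \<union> E2) \<inter> S \<inter> R = E1 \<inter> S" "(E1 \<union> E2) \<inter> S - R = E2 \<inter> S"
      "W \<inter> S \<inter> R = W \<inter> R \<inter> S" "W \<inter> S - R = (W - R) \<inter> S"
      using E1(2) E2(2) by auto
    have "(E1 \<union> E2) \<inter> S \<in> lmeasurable"
      using E1(1) E2(1) S by (intro fmeasurable.Int) auto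
    then show ?thesis
      using split[of "(E1 \<union> E2) \<inter> S"] split[of "W \<inter> S"] E1 E2 insert.prems S that
      unfolding * by (simp add: algebra_simps fmeasurable.Int)
  qed
  moreover have "measure lebesgue ((E1 \<union> E2) \<inter> R) = \<delta> * measure lebesgue (W \<inter> R)"
    using E1 by (simp only: E)
  ultimately show ?case
    by (intro bexI[of _ "E1 \<union> E2"]) auto
qed

section \<open>Finite families witnessing lower bounds for the halo function\<close>

text \<open>Continuity from below along the partial unions of an enumeration of
  \<open>C\<close>.\<close>

lemma less_emeasure_Union_countable:
  assumes "countable C" "C \<subseteq> sets M" "l < emeasure M (\<Union>C)"
  obtains F where "finite F" "F \<subseteq> C" "l < emeasure M (\<Union>F)"
proof (cases "C = {}")
  case True
  with assms that show ?thesis by auto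
next
  case False
  define f where "f = from_nat_into C"
  have f: "range f = C"
    unfolding f_def by (rule range_from_nat_into[OF False assms(1)])
  define G where "G n = \<Union>(f ` {..n})" for n
  have fM: "f i \<in> sets M" for i
    using f assms(2) by auto
  have "(SUP n. emeasure M (G n)) = emeasure M (\<Union>n. G n)"
    using fM by (intro SUP_emeasure_incseq) (auto simp: G_def incseq_def, force)
  moreover have "(\<Union>n. G n) = \<Union>C"
    unfolding G_def f[symmetric] by auto
  ultimately obtain n where "l < emeasure M (G n)"
    using assms(3) by (metis less_SUP_iff)
  then show ?thesis
    using that[of "f ` {..n}"] f by (auto simp: G_def)
qed

text \<open>The average of \<open>A\<close> over \<open>R\<close> exceeds \<open>t\<close>, written
  without division. Finite measure of \<open>R\<close> is demanded because \<open>measure\<close> is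
  0 on sets of infinite measure, where the inequality would hold as soon as
  \<open>A \<inter> R\<close> has positive finite measure.\<close>

definition dense_in :: "real \<Rightarrow> 'a::euclidean_space set \<Rightarrow> 'a set \<Rightarrow> bool" where
  "dense_in t A R \<longleftrightarrow> R \<in> lmeasurable \<and> t * measure lebesgue R < measure lebesgue (A \<inter> R)"

lemma average_indicator:
  assumes "R \<in> sets lebesgue" "A \<in> sets lebesgue"
  shows "average R (indicator A) = emeasure lebesgue (A \<inter> R) / emeasure lebesgue R"
  unfolding average_def using assms
  by (simp add: indicator_inter_arith[symmetric] sets.Int)

lemma average_dense:
  fixes A R :: "(real^'n) set"
  assumes R: "R \<in> lmeasurable" and A: "A \<in> sets lebesgue" and "0 < measure lebesgue R"
  shows "average R (indicator A) = ennreal (measure lebesgue (A \<inter> R) / measure lebesgue R)"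
proof -
  have "A \<inter> R \<in> lmeasurable"
    using assms by (metis fmeasurable_Int_fmeasurable inf_commute)
  then show ?thesis
    using assms by (subst average_indicator) 
      (auto simp: emeasure_eq_measure2 divide_ennreal)
qed

text \<open>For \<open>R\<close> of positive finite measure this is clearing the denominator. For
  \<open>R\<close> of measure 0 or \<infinity> both sides fail: the quotient in
  \<open>ennreal\<close> is then 0.\<close>

lemma average_gt_iff_dense_in:
  fixes A R :: "(real^'n) set"
  assumes R: "open R" and A: "A \<in> lmeasurable" and "0 < t"
  shows "ennreal t < average R (indicator A) \<longleftrightarrow> dense_in t A R"
proof -
  have Rs: "R \<in> sets lebesgue" and As: "A \<in> sets lebesgue"
    using R A by auto
  have AR: "A \<inter> R \<in> lmeasurable"
    using A Rs by (rule fmeasurable_Int_fmeasurable)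
  show ?thesis
  proof (cases "R \<in> lmeasurable \<and> 0 < measure lebesgue R")
    case True
    then show ?thesis
      using average_dense[of R A] As \<open>0 < t\<close>
      by (auto simp: dense_in_def ennreal_less_iff field_simps)
  next
    case False
    have "\<not> dense_in t A R"
    proof
      assume *: "dense_in t A R"
      then have "measure lebesgue (A \<inter> R) \<le> measure lebesgue R"
        by (intro measure_mono_fmeasurable) (use AR in \<open>auto simp: dense_in_def\<close>)
      with * False show False
        by (auto simp: dense_in_def zero_less_measure_iff measure_le_0_iff)
    qed
    moreover have "average R (indicator A) = 0"
    proof (cases "R \<in> lmeasurable")
      case True
      with False have "emeasure lebesgue R = 0"
        by (simp add: emeasure_eq_measure2 zero_less_measure_iff)
      then have "emeasure lebesgue (A \<inter> R) = 0"
        by (metis Int_lower2 Rs emeasure_mono le_zero_eq)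
      then show ?thesis
        by (simp add: average_indicator Rs As)
    next
      case False
      then have "emeasure lebesgue R = top"
        using Rs by (simp add: fmeasurable_def less_top[symmetric] del: emeasure_completion)
      then show ?thesis
        by (simp add: average_indicator Rs As)
    qed
    ultimately show ?thesis
      by simp
  qed
qed

lemma maximal_operator_superlevel:
  fixes A :: "(real^'n) set"
  assumes "\<forall>R\<in>B. open R" and "A \<in> lmeasurable" and "0 < t"
  shows "{x. ennreal t < maximal_operator B (indicator A) x} = \<Union>{R\<in>B. dense_in t A R}"
proof -
  have "(\<lambda>y. ennreal \<bar>indicator A y\<bar>) = (indicator A :: real^'n \<Rightarrow> ennreal)"
    by (auto simp: indicator_def)
  then show ?thesis
    using assms average_gt_iff_dense_in[of _ A t]
    by (auto simp: maximal_operator_def less_SUP_iff)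
qed

text \<open>A certificate that the halo function at \<open>u\<close> is at least the measure of
  \<open>\<Union>F\<close> divided by that of \<open>A\<close>. Finiteness of \<open>F\<close> makes
  it possible to perturb \<open>u\<close> and to fill all members of \<open>F\<close>
  simultaneously.\<close>

definition halo_witness ::
  "(real^'n) set set \<Rightarrow> real \<Rightarrow> (real^'n) set \<Rightarrow> (real^'n) set set \<Rightarrow> bool" where
  "halo_witness B u A F \<longleftrightarrow> A \<in> lmeasurable \<and> 0 < measure lebesgue A \<and> finite F \<and> F \<subseteq> B \<and>
     (\<forall>R\<in>F. dense_in (1 / u) A R)"

lemma halo_witness_lmeasurable:
  "halo_witness B u A F \<Longrightarrow> \<Union>F \<in> lmeasurable"
  unfolding halo_witness_def dense_in_def by (intro fmeasurable.finite_Union) auto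

lemma less_divide_ennreal_iff:
  fixes l x :: ennreal
  assumes a: "0 < a"
  shows "l < x / ennreal a \<longleftrightarrow> l * ennreal a < x"
proof -
  have "x / ennreal a \<le> l \<longleftrightarrow> x \<le> l * ennreal a"
  proof
    assume "x / ennreal a \<le> l"
    then have "x / ennreal a * ennreal a \<le> l * ennreal a"
      by (rule mult_right_mono) simp
    then show "x \<le> l * ennreal a"
      using a by (simp add: ennreal_divide_times)
  next
    assume "x \<le> l * ennreal a"
    then show "x / ennreal a \<le> l"
      using a by (intro divide_le_posI_ennreal) (auto simp: mult.commute)
  qed
  then show ?thesis
    by (simp add: not_le[symmetric])
qed

text \<open>The superlevel set is a union of open members of \<open>B\<close>. By the Lindelof
  property countably many of them have the same union, and finitely many of these already exceed a
  bound strictly below its measure. Conversely, the union of a witness lies inside the superlevel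
  set.\<close>

lemma less_halo_iff:
  fixes B :: "(real^'n) set set"
  assumes B: "\<forall>R\<in>B. open R" and u: "0 < u"
  shows "l < halo B u \<longleftrightarrow>
    (\<exists>A F. halo_witness B u A F \<and> l < ennreal (measure lebesgue (\<Union>F) / measure lebesgue A))"
proof
  assume "l < halo B u"
  then obtain A where A: "A \<in> sets lebesgue" "0 < emeasure lebesgue A" "emeasure lebesgue A < top"
    and l: "l < emeasure lebesgue {x. ennreal (1 / u) < maximal_operator B (indicator A) x}
                  / emeasure lebesgue A"
    unfolding halo_def less_SUP_iff by (auto simp: infinity_ennreal_def)
  from A have A: "A \<in> lmeasurable" "0 < emeasure lebesgue A"
    by (auto simp: fmeasurable_def)
  have a: "emeasure lebesgue A = ennreal (measure lebesgue A)" "0 < measure lebesgue A"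
    using A by (auto simp: emeasure_eq_measure2)
  let ?C = "{R\<in>B. dense_in (1 / u) A R}"
  obtain C where C: "C \<subseteq> ?C" "countable C" "\<Union>C = \<Union>?C"
    using Lindelof[of ?C] B by auto
  have "l < emeasure lebesgue (\<Union>C) / ennreal (measure lebesgue A)"
    using l u by (simp add: C maximal_operator_superlevel[OF B A(1)] a)
  then have *: "l * ennreal (measure lebesgue A) < emeasure lebesgue (\<Union>C)"
    using a(2) by (simp add: less_divide_ennreal_iff)
  obtain F where F: "finite F" "F \<subseteq> C" "l * ennreal (measure lebesgue A) < emeasure lebesgue (\<Union>F)"
    using less_emeasure_Union_countable[OF C(2) _ *] C(1) by (auto simp: dense_in_def subset_iff)
  have "halo_witness B u A F"
    using A(1) a(2) C(1) F by (auto simp: halo_witness_def)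
  moreover from halo_witness_lmeasurable[OF this]
  have "l < ennreal (measure lebesgue (\<Union>F) / measure lebesgue A)"
    using F(3) a(2)
    by (simp add: less_divide_ennreal_iff divide_ennreal[symmetric] emeasure_eq_measure2)
  ultimately show "\<exists>A F. halo_witness B u A F \<and>
      l < ennreal (measure lebesgue (\<Union>F) / measure lebesgue A)"
    by blast
next
  assume "\<exists>A F. halo_witness B u A F \<and> l < ennreal (measure lebesgue (\<Union>F) / measure lebesgue A)"
  then obtain A F where AF: "halo_witness B u A F"
    and l: "l < ennreal (measure lebesgue (\<Union>F) / measure lebesgue A)"
    by blast
  have A: "A \<in> lmeasurable" "0 < measure lebesgue A"
    using AF by (auto simp: halo_witness_def)
  let ?H = "{x. ennreal (1 / u) < maximal_operator B (indicator A) x}"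
  have H: "?H = \<Union>{R\<in>B. dense_in (1 / u) A R}"
    using u by (intro maximal_operator_superlevel[OF B A(1)]) simp
  \<comment> \<open>Monotonicity of \<open>emeasure\<close> requires the larger set to be
    measurable.\<close>
  have "open ?H"
    unfolding H using B by auto
  then have "emeasure lebesgue (\<Union>F) \<le> emeasure lebesgue ?H"
    using AF by (intro emeasure_mono) (auto simp: H halo_witness_def)
  then have "emeasure lebesgue (\<Union>F) / emeasure lebesgue A \<le> emeasure lebesgue ?H / emeasure lebesgue A"
    by (rule divide_right_mono_ennreal)
  moreover have "emeasure lebesgue (\<Union>F) / emeasure lebesgue A =
      ennreal (measure lebesgue (\<Union>F) / measure lebesgue A)"
    using A halo_witness_lmeasurable[OF AF] by (simp add: emeasure_eq_measure2 divide_ennreal)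
  moreover have "emeasure lebesgue ?H / emeasure lebesgue A \<le> halo B u"
  proof -
    have "0 < emeasure lebesgue A"
      unfolding emeasure_eq_measure2[OF A(1)] using A(2) by simp
    with A(1) have "A \<in> {A \<in> sets lebesgue. 0 < emeasure lebesgue A \<and> emeasure lebesgue A < \<infinity>}"
      by (simp add: fmeasurable_def del: emeasure_completion)
    then show ?thesis
      unfolding halo_def by (rule SUP_upper)
  qed
  ultimately show "l < halo B u"
    using l by simp
qed

lemma halo_mono:
  fixes B :: "(real^'n) set set"
  assumes B: "\<forall>R\<in>B. open R" and u: "0 < u" "u \<le> v"
  shows "halo B u \<le> halo B v"
proof (rule ccontr)
  assume "\<not> halo B u \<le> halo B v"
  then obtain A F where AF: "halo_witness B u A F"
    "halo B v < ennreal (measure lebesgue (\<Union>F) / measure lebesgue A)"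
    using less_halo_iff[OF B u(1)] by (auto simp: not_le)
  have "measure lebesgue R / v \<le> measure lebesgue R / u" for R :: "(real^'n) set"
    using u by (intro divide_left_mono) auto
  then have "halo_witness B v A F"
    using AF(1) by (fastforce simp: halo_witness_def dense_in_def intro: le_less_trans)
  with AF(2) show False
    using less_halo_iff[OF B, of v] u by (meson less_irrefl order_less_le_trans)
qed

section \<open>Continuity of the halo function\<close>

text \<open>The parameter \<open>(1 - \<delta>) / (1 / u - \<delta>)\<close> is the solution
  \<open>v\<close> of \<open>\<delta> + (1 - \<delta>) / v = 1 / u\<close>. If \<open>E\<close>
  fills the fraction \<delta> of every \<open>R - A\<close>, then
  \<open>(A \<union> E) \<inter> R\<close> has measure \<open>1 - \<delta>\<close> times that of
  \<open>A \<inter> R\<close> plus \<delta> times that of \<open>R\<close>, so density above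
  \<open>1 / v\<close> becomes density above \<open>1 / u\<close>.\<close>

lemma halo_witness_enlarge:
  fixes B :: "(real^'n) set set"
  assumes u: "1 < u" and \<delta>: "0 < \<delta>" "\<delta> < 1 / u"
    and AF: "halo_witness B ((1 - \<delta>) / (1 / u - \<delta>)) A F"
  obtains A' where "halo_witness B u A' F"
    "measure lebesgue A' \<le> measure lebesgue A + \<delta> * measure lebesgue (\<Union>F)"
proof -
  have \<delta>1: "\<delta> < 1"
    using u \<delta> by (smt (verit) divide_less_eq_1)
  have A: "A \<in> lmeasurable" "0 < measure lebesgue A" and F: "finite F" "F \<subseteq> B"
    and dense: "\<And>R. R \<in> F \<Longrightarrow> dense_in ((1 / u - \<delta>) / (1 - \<delta>)) A R"
    using AF by (auto simp: halo_witness_def)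
  have U: "\<Union>F \<in> lmeasurable"
    using AF by (rule halo_witness_lmeasurable)
  have Fl: "F \<subseteq> lmeasurable"
    using dense by (auto simp: dense_in_def)
  obtain E where E: "E \<in> lmeasurable" "E \<subseteq> \<Union>F - A"
    "measure lebesgue E = \<delta> * measure lebesgue (\<Union>F - A)"
    "\<forall>R\<in>F. measure lebesgue (E \<inter> R) = \<delta> * measure lebesgue ((\<Union>F - A) \<inter> R)"
    using lmeasurable_subset_proportion_family[OF F(1) Fl _ \<delta>(1) \<delta>1, of "\<Union>F - A"] A U
    by (auto intro: fmeasurable.Diff)
  have A': "A \<union> E \<in> lmeasurable"
    using A E by auto
  have "measure lebesgue (\<Union>F - A) \<le> measure lebesgue (\<Union>F)"
    using U A by (intro measure_mono_fmeasurable) auto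
  then have "measure lebesgue E \<le> \<delta> * measure lebesgue (\<Union>F)"
    using \<delta> E(3) by (simp add: mult_left_mono)
  then have le: "measure lebesgue (A \<union> E) \<le> measure lebesgue A + \<delta> * measure lebesgue (\<Union>F)"
    using measure_Un_le[of A lebesgue E] A E by auto
  have "dense_in (1 / u) (A \<union> E) R" if R: "R \<in> F" for R
  proof -
    have Rl: "R \<in> lmeasurable"
      using Fl R by auto
    have "(\<Union>F - A) \<inter> R = R - A" "(A \<union> E) \<inter> R = (A \<inter> R) \<union> (E \<inter> R)"
      "(A \<inter> R) \<inter> (E \<inter> R) = {}" "R = (A \<inter> R) \<union> (R - A)" "(A \<inter> R) \<inter> (R - A) = {}"
      using R E(2) by auto
    note sets = this
    have "measure lebesgue ((A \<union> E) \<inter> R) = measure lebesgue (A \<inter> R) + measure lebesgue (E \<inter> R)"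
      using measure_Un3[of "A \<inter> R" lebesgue "E \<inter> R"] A E Rl
      unfolding sets(2) using sets(3) by (simp add: fmeasurable.Int)
    also have "measure lebesgue (E \<inter> R) = \<delta> * measure lebesgue (R - A)"
      using E(4) R sets(1) by simp
    also have "measure lebesgue (R - A) = measure lebesgue R - measure lebesgue (A \<inter> R)"
      using measure_Un3[of "A \<inter> R" lebesgue "R - A"] A Rl sets(4)[symmetric] sets(5)
      by (simp add: fmeasurable.Int fmeasurable.Diff)
    finally have "measure lebesgue ((A \<union> E) \<inter> R) =
        (1 - \<delta>) * measure lebesgue (A \<inter> R) + \<delta> * measure lebesgue R"
      by (simp add: algebra_simps)
    moreover have "(1 / u - \<delta>) * measure lebesgue R < (1 - \<delta>) * measure lebesgue (A \<inter> R)"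
      using dense[OF R] \<delta>1 by (simp add: dense_in_def field_simps)
    ultimately show ?thesis
      using Rl by (simp add: dense_in_def algebra_simps)
  qed
  moreover have "0 < measure lebesgue (A \<union> E)"
    using measure_mono_fmeasurable[of A "A \<union> E" lebesgue] A A' by auto
  ultimately have "halo_witness B u (A \<union> E) F"
    using A' F by (simp add: halo_witness_def)
  with le that show ?thesis
    by blast
qed

text \<open>A witness at \<open>u\<close> consists of finitely many strict inequalities that are
  continuous in \<open>u\<close>, so the same sets form a witness at all nearby
  \<open>v\<close>.\<close>

lemma halo_lower_semicontinuous:
  fixes B :: "(real^'n) set set"
  assumes B: "\<forall>R\<in>B. open R" and u: "0 < u" and l: "l < halo B u"
  shows "\<forall>\<^sub>F v in nhds u. l < halo B v"
proof -
  obtain A F where AF: "halo_witness B u A F"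
    "l < ennreal (measure lebesgue (\<Union>F) / measure lebesgue A)"
    using l less_halo_iff[OF B u] by blast
  have "\<forall>\<^sub>F v in nhds u. dense_in (1 / v) A R" if "R \<in> F" for R
  proof -
    have R: "R \<in> lmeasurable" "1 / u * measure lebesgue R < measure lebesgue (A \<inter> R)"
      using AF(1) that by (auto simp: halo_witness_def dense_in_def)
    have "((\<lambda>v. 1 / v * measure lebesgue R) \<longlongrightarrow> 1 / u * measure lebesgue R) (nhds u)"
      using u by (intro tendsto_intros filterlim_ident) auto
    from order_tendstoD(2)[OF this R(2)] show ?thesis
      using R(1) by (simp add: dense_in_def)
  qed
  then have "\<forall>\<^sub>F v in nhds u. \<forall>R\<in>F. dense_in (1 / v) A R"
    using AF(1) by (intro eventually_ball_finite) (auto simp: halo_witness_def)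
  moreover have "\<forall>\<^sub>F v in nhds u. 0 < v"
    using u eventually_nhds_in_open[of "{0<..}" u] by simp
  ultimately show ?thesis
  proof eventually_elim
    case (elim v)
    then have "halo_witness B v A F"
      using AF(1) by (simp add: halo_witness_def)
    then show ?case
      using less_halo_iff[OF B elim(2)] AF(2) by blast
  qed
qed

text \<open>By monotonicity a single \<open>v > u\<close> with value below \<open>l\<close>
  suffices. A witness at \<open>v\<close> with ratio above \<open>q\<close> would, after
  enlargement, have ratio above \<open>1 / (1 / q + \<delta>)\<close> at \<open>u\<close>, which
  exceeds the value \<open>p\<close> at \<open>u\<close> once \<delta> is small.\<close>

lemma halo_upper_semicontinuous:
  fixes B :: "(real^'n) set set"
  assumes B: "\<forall>R\<in>B. open R" and u: "1 < u" and l: "halo B u < l"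
  shows "\<forall>\<^sub>F v in nhds u. halo B v < l"
proof -
  obtain l' where l': "halo B u < l'" "l' < l"
    using l dense by blast
  obtain p where p: "halo B u = ennreal p" "0 \<le> p"
    using l'(1) by (cases "halo B u") auto
  obtain q where q: "l' = ennreal q" "0 \<le> q"
    using l'(2) by (cases l') auto
  have pq: "p < q"
    using l'(1) p q by (simp add: ennreal_less_iff)
  \<comment> \<open>The first term keeps \<delta> below \<open>1 / u\<close>; the second gives
    \<open>p * \<delta> < 1 - p / q\<close>, that is, \<open>p * (1 / q + \<delta>) < 1\<close>. The
    summand 1 in the denominator covers the case \<open>p = 0\<close>.\<close>
  define \<delta> where "\<delta> = min (1 / (2 * u)) ((1 - p / q) / (2 * (p + 1)))"
  have "0 < (1 - p / q) / (2 * (p + 1))"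
    using pq p by (intro divide_pos_pos) auto
  then have \<delta>: "0 < \<delta>" "\<delta> < 1 / u"
    using u by (auto simp: \<delta>_def min_less_iff_disj field_simps)
  have "p * \<delta> \<le> p * ((1 - p / q) / (2 * (p + 1)))"
    using p by (intro mult_left_mono) (auto simp: \<delta>_def)
  also have "\<dots> = (1 - p / q) * (p / (2 * (p + 1)))"
    by simp
  also have "\<dots> < (1 - p / q) * 1"
    using pq p by (intro mult_strict_left_mono) (auto simp: field_simps)
  finally have p\<delta>: "p * \<delta> < 1 - p / q"
    by simp
  define v where "v = (1 - \<delta>) / (1 / u - \<delta>)"
  have "\<delta> < \<delta> * u"
    using \<delta> u by simp
  then have uv: "u < v"
    using \<delta> u by (simp add: v_def less_divide_eq right_diff_distrib mult.commute)
  have "halo B v \<le> ennreal q"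
  proof (rule ccontr)
    assume "\<not> halo B v \<le> ennreal q"
    then obtain A F where AF: "halo_witness B v A F"
      "ennreal q < ennreal (measure lebesgue (\<Union>F) / measure lebesgue A)"
      using less_halo_iff[OF B, of v "ennreal q"] u uv by (auto simp: not_le)
    let ?a = "measure lebesgue A" and ?h = "measure lebesgue (\<Union>F)"
    have a: "0 < ?a"
      using AF(1) by (simp add: halo_witness_def)
    then have qa: "q * ?a < ?h"
      using AF(2) q by (simp add: ennreal_less_iff field_simps)
    obtain A' where A': "halo_witness B u A' F" "measure lebesgue A' \<le> ?a + \<delta> * ?h"
      using halo_witness_enlarge[OF u \<delta>] AF(1) unfolding v_def by blast
    have a': "0 < measure lebesgue A'"
      using A' by (simp add: halo_witness_def)
    \<comment> \<open>Applied with \<open>halo B u\<close> itself as the bound, the characterization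
      says that no witness at \<open>u\<close> has a ratio above it.\<close>
    have "\<not> halo B u < ennreal (?h / measure lebesgue A')"
      using less_halo_iff[OF B, of u "halo B u"] A'(1) u by auto
    then have "?h / measure lebesgue A' \<le> p"
      using p by (simp add: not_less ennreal_le_iff)
    then have "?h \<le> p * measure lebesgue A'"
      using a' by (simp add: field_simps)
    also have "\<dots> \<le> p * (?a + \<delta> * ?h)"
      using A'(2) p by (intro mult_left_mono)
    also have "\<dots> \<le> p * (?h / q + \<delta> * ?h)"
      using qa pq p by (intro mult_left_mono) (auto simp: field_simps)
    also have "\<dots> = (p / q + p * \<delta>) * ?h"
      by (simp add: algebra_simps)
    also have "\<dots> < 1 * ?h"
      using p\<delta> qa a q by (intro mult_strict_right_mono) (auto intro: le_less_trans[rotated])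
    finally show False
      by simp
  qed
  then have v: "halo B v < l"
    using l'(2) q by simp
  have "\<forall>\<^sub>F w in nhds u. 0 < w \<and> w < v"
    using u uv eventually_nhds_in_open[of "{0<..<v}" u] by simp
  then show ?thesis
    by eventually_elim (use v halo_mono[OF B] in \<open>meson le_less_trans less_imp_le\<close>)
qed

lemma continuous_on_halo:
  fixes B :: "(real^'n) set set"
  assumes "\<forall>R\<in>B. open R"
  shows "continuous_on {1<..} (halo B)"
proof -
  have "isCont (halo B) u" if "1 < u" for u
  proof -
    have "(halo B \<longlongrightarrow> halo B u) (nhds u)"
      using halo_lower_semicontinuous[OF assms] halo_upper_semicontinuous[OF assms] that
      by (intro order_tendstoI) auto
    then show ?thesis
      by (simp add: continuous_at tendsto_at_iff_tendsto_nhds)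
  qed
  then show ?thesis
    by (auto intro: continuous_at_imp_continuous_on)
qed

section \<open>Scaling and covering: small sets with large averages\<close>

lemma lmeasurable_homothety:
  fixes S :: "'a::euclidean_space set"
  assumes S: "S \<in> lmeasurable" and r: "0 < r"
  shows "(\<lambda>x. a + r *\<^sub>R x) ` S \<in> lmeasurable"
    and "measure lebesgue ((\<lambda>x. a + r *\<^sub>R x) ` S) = r ^ DIM('a) * measure lebesgue S"
proof -
  have "(\<lambda>x. r *\<^sub>R x) ` S = (*\<^sub>R) (1 / r) -` S \<inter> space lebesgue"
    using r by (auto intro: image_eqI[of _ _ "(1 / r) *\<^sub>R x" for x])
  also have "\<dots> \<in> sets lebesgue"
    using S by (intro measurable_sets[OF lebesgue_measurable_scaling]) auto
  finally have rS: "(\<lambda>x. r *\<^sub>R x) ` S \<in> sets lebesgue" .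
  have "emeasure lebesgue ((\<lambda>x. r *\<^sub>R x) ` S) = ennreal (r ^ DIM('a)) * emeasure lebesgue S"
    using emeasure_lebesgue_affine[of r 0 S] r by simp
  also have "\<dots> < top"
    unfolding emeasure_eq_measure2[OF S]
    by (simp add: ennreal_mult_less_top)
  finally have "(\<lambda>x. r *\<^sub>R x) ` S \<in> lmeasurable"
    using rS by (simp add: fmeasurable_def del: emeasure_completion)
  from measurable_translation[OF this, of a] show "(\<lambda>x. a + r *\<^sub>R x) ` S \<in> lmeasurable"
    by (simp add: image_image)
  show "measure lebesgue ((\<lambda>x. a + r *\<^sub>R x) ` S) = r ^ DIM('a) * measure lebesgue S"
    using measure_lebesgue_affine[of r a S] r by (simp add: add.commute)
qed

text \<open>Averaging the overlap over all translation vectors, of which only those in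
  \<^term>\<open>ball 0 2\<close> contribute.\<close>

lemma exists_translate_overlap:
  fixes G H :: "'a::euclidean_space set"
  assumes GH: "G \<in> sets borel" "H \<in> sets borel" "G \<subseteq> ball 0 1" "H \<subseteq> ball 0 1"
  shows "\<exists>t. measure lborel G * measure lborel H
           \<le> 2 * measure lborel (ball 0 2 :: 'a set) * measure lborel (G \<inter> (+) t ` H)"
proof (rule ccontr)
  let ?b = "measure lborel (ball 0 2 :: 'a set)" and ?g = "measure lborel G" and ?h = "measure lborel H"
  assume "\<not> ?thesis"
  then have small: "2 * ?b * measure lborel (G \<inter> (+) t ` H) < ?g * ?h" for t
    by (simp add: not_le)
  have b: "0 < ?b"
    by (simp add: content_ball_pos)
  have fin: "emeasure lborel X = ennreal (measure lborel X)" if "X \<subseteq> ball 0 2" "X \<in> sets borel"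
    for X :: "'a set"
    using that by (intro emeasure_eq_ennreal_measure)
      (metis bounded_ball bounded_subset emeasure_bounded_finite infinity_ennreal_def less_irrefl)
  have [measurable]: "G \<in> sets borel" "H \<in> sets borel"
    by fact+
  \<comment> \<open>The double integral of \<open>f\<close> is evaluated in both orders: over
    \<open>s\<close> first it yields the product of the measures of \<open>G\<close> and
    \<open>H\<close>, over \<open>x\<close> first the overlaps of \<open>G\<close> with translates
    of \<open>H\<close>.\<close>
  define f :: "'a \<Rightarrow> 'a \<Rightarrow> ennreal" where "f x s = indicator G x * indicator H (x + s)" for x s
  have [measurable]: "case_prod f \<in> borel_measurable (lborel \<Otimes>\<^sub>M lborel)"
    unfolding f_def by measurable
  have sub: "ball 0 1 \<subseteq> (ball 0 2 :: 'a set)"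
    by (intro subset_ball) simp
  have "(\<integral>\<^sup>+ s. indicator H (x + s) \<partial>lborel) = emeasure lborel H" for x
  proof -
    have "emeasure lborel H = (\<integral>\<^sup>+ s. indicator H s \<partial>distr lborel borel ((+) x))"
      by (simp add: lborel_distr_plus)
    also have "\<dots> = (\<integral>\<^sup>+ s. indicator H (x + s) \<partial>lborel)"
      by (rule nn_integral_distr) auto
    finally show ?thesis ..
  qed
  then have "(\<integral>\<^sup>+ x. \<integral>\<^sup>+ s. f x s \<partial>lborel \<partial>lborel) = (\<integral>\<^sup>+ x. indicator G x * emeasure lborel H \<partial>lborel)"
    unfolding f_def by (simp add: nn_integral_cmult)
  also have "\<dots> = emeasure lborel G * emeasure lborel H"
    by (simp add: nn_integral_multc)
  also have "\<dots> = ennreal (?g * ?h)"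
    using GH sub by (subst (1 2) fin) (auto simp: ennreal_mult)
  finally have eq: "(\<integral>\<^sup>+ x. \<integral>\<^sup>+ s. f x s \<partial>lborel \<partial>lborel) = ennreal (?g * ?h)" .
  have le: "(\<integral>\<^sup>+ x. f x s \<partial>lborel) \<le> ennreal (?g * ?h / (2 * ?b)) * indicator (ball 0 2) s" for s
  proof -
    have eq: "f x s = indicator (G \<inter> (+) (- s) ` H) x" for x
    proof -
      have "x \<in> (+) (- s) ` H \<longleftrightarrow> x + s \<in> H"
        by (auto simp: image_iff intro: bexI[of _ "x + s"])
      then show ?thesis
        by (simp add: f_def indicator_def)
    qed
    have "(+) (- s) ` H = (\<lambda>x. x + s) -` H \<inter> space borel"
      by (auto intro: image_eqI[of _ _ "x + s" for x])
    moreover have "(\<lambda>x. x + s) -` H \<inter> space borel \<in> sets borel"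
      by (intro measurable_sets[OF _ GH(2)]) simp
    ultimately have m: "(+) (- s) ` H \<in> sets borel"
      by simp
    have *: "(\<integral>\<^sup>+ x. f x s \<partial>lborel) = emeasure lborel (G \<inter> (+) (- s) ` H)"
      unfolding eq using GH(1) m by (intro nn_integral_indicator) auto
    show ?thesis
    proof (cases "s \<in> ball 0 2")
      case True
      have "emeasure lborel (G \<inter> (+) (- s) ` H) = ennreal (measure lborel (G \<inter> (+) (- s) ` H))"
        using GH m sub by (intro fin) auto
      also have "\<dots> \<le> ennreal (?g * ?h / (2 * ?b))"
        using small[of "- s"] b by (intro ennreal_leI) (simp add: field_simps)
      finally show ?thesis
        using True * by simp
    next
      case False
      have "G \<inter> (+) (- s) ` H = {}"
      proof (rule ccontr)
        assume "G \<inter> (+) (- s) ` H \<noteq> {}"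
        then obtain y where "y \<in> H" "y - s \<in> G"
          by auto
        then have "norm y < 1" "norm (y - s) < 1"
          using GH by auto
        then have "norm (y - (y - s)) < 2"
          using norm_triangle_ineq4[of y "y - s"] by linarith
        with False show False
          by simp
      qed
      with * show ?thesis
        by simp
    qed
  qed
  have "ennreal (?g * ?h) = (\<integral>\<^sup>+ s. \<integral>\<^sup>+ x. f x s \<partial>lborel \<partial>lborel)"
    unfolding eq[symmetric] by (rule lborel_pair.Fubini'[symmetric]) measurable
  also have "\<dots> \<le> (\<integral>\<^sup>+ s. ennreal (?g * ?h / (2 * ?b)) * indicator (ball 0 2 :: 'a set) s \<partial>lborel)"
    by (intro nn_integral_mono le)
  also have "\<dots> = ennreal (?g * ?h / (2 * ?b)) * ennreal ?b"
    by (simp add: nn_integral_cmult_indicator fin)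
  also have "\<dots> = ennreal (?g * ?h / 2)"
    using b by (simp add: ennreal_mult[symmetric])
  \<comment> \<open>The factor 2 in the claim leaves room for the loss of strictness under the
    integral. Since \<open>small\<close> at translation 0 makes the product positive, it cannot be
    at most its half.\<close>
  finally have "?g * ?h \<le> ?g * ?h / 2"
    by (simp add: ennreal_le_iff)
  moreover have "0 \<le> 2 * ?b * measure lborel (G \<inter> (+) 0 ` H)"
    by simp
  ultimately show False
    using small[of 0] by linarith
qed

text \<open>Greedy choice: some translate of \<open>H\<close> meets the uncovered part in at least
  the fraction \<open>q\<close> of its measure, so each further translate shrinks that part by the
  factor \<open>1 - q\<close>.\<close>

lemma translates_cover_unit_ball:
  fixes H :: "'a::euclidean_space set"
  assumes H: "open H" "H \<subseteq> ball 0 1"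
  defines "q \<equiv> measure lebesgue H / (2 * measure lebesgue (ball 0 2 :: 'a set))"
  shows "\<exists>T. finite T \<and> card T \<le> N \<and>
    measure lebesgue (ball 0 1 - (\<Union>t\<in>T. (+) t ` H)) \<le> (1 - q) ^ N * measure lebesgue (ball 0 1 :: 'a set)"
proof (induction N)
  case 0
  then show ?case
    by (intro exI[of _ "{}"]) simp
next
  case (Suc N)
  then obtain T where T: "finite T" "card T \<le> N" and le:
    "measure lebesgue (ball 0 1 - (\<Union>t\<in>T. (+) t ` H)) \<le> (1 - q) ^ N * measure lebesgue (ball 0 1 :: 'a set)"
    by blast
  define G where "G = ball 0 1 - (\<Union>t\<in>T. (+) t ` H)"
  have "open (\<Union>t\<in>T. (+) t ` H)"
    using H(1) by (intro open_UN ballI open_translation)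
  then have G: "G \<in> sets borel" "G \<subseteq> ball 0 1"
    unfolding G_def by auto
  obtain t where t: "measure lborel G * measure lborel H
           \<le> 2 * measure lborel (ball 0 2 :: 'a set) * measure lborel (G \<inter> (+) t ` H)"
    using exists_translate_overlap[OF G(1) _ G(2) H(2)] H(1) by auto
  have b: "0 < measure lebesgue (ball 0 2 :: 'a set)"
    by (simp add: content_ball_pos)
  have tH: "(+) t ` H \<in> sets borel"
    using H(1) by (intro borel_open open_translation)
  have Gl: "G \<in> lmeasurable"
    using G by (metis bounded_ball bounded_set_imp_lmeasurable bounded_subset sets_completionI_sets sets_lborel)
  have tl: "(+) t ` H \<in> sets lebesgue"
    using tH by auto
  have "q * measure lebesgue G \<le> measure lebesgue (G \<inter> (+) t ` H)"
    using t b G tH H(1) by (simp add: q_def field_simps sets.Int)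
  moreover have "measure lebesgue (G - (+) t ` H) = measure lebesgue G - measure lebesgue (G \<inter> (+) t ` H)"
    using measurable_measure_Diff[of G lebesgue "G \<inter> (+) t ` H"] Gl tl
    by (simp add: Diff_Int_distrib sets.Int fmeasurableD Diff_Int2 Diff_Int)
  ultimately have "measure lebesgue (G - (+) t ` H) \<le> (1 - q) * measure lebesgue G"
    by (simp add: algebra_simps)
  also have "\<dots> \<le> (1 - q) * ((1 - q) ^ N * measure lebesgue (ball 0 1 :: 'a set))"
  proof (intro mult_left_mono)
    have "measure lebesgue H \<le> measure lebesgue (ball 0 2 :: 'a set)"
      using H by (intro measure_mono_fmeasurable) (auto intro: less_trans)
    then have "measure lebesgue H \<le> 2 * measure lebesgue (ball 0 2 :: 'a set)"
      using b by linarith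
    then show "0 \<le> 1 - q"
      using b by (simp add: q_def field_simps)
  qed (use le in \<open>simp add: G_def\<close>)
  finally have "measure lebesgue (ball 0 1 - (\<Union>t\<in>insert t T. (+) t ` H))
      \<le> (1 - q) ^ Suc N * measure lebesgue (ball 0 1 :: 'a set)"
    by (simp add: G_def Diff_eq Int_ac Compl_Un mult.assoc)
  \<comment> \<open>Only an inequality is available, since the new \<open>t\<close> may already
    belong to \<open>T\<close>, for instance when the uncovered part is null.\<close>
  moreover have "card (insert t T) \<le> Suc N"
    using T by (simp add: card_insert_if)
  ultimately show ?case
    using T(1) by (intro exI[of _ "insert t T"]) simp
qed

text \<open>Bernoulli bounds \<open>1 + real N * q\<close> by \<open>(1 + q) ^ N\<close>, and
  \<open>(1 - q) * (1 + q)\<close> is at most 1. This quantifies how many translates are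
  enough.\<close>

lemma one_minus_power_le:
  fixes q :: real
  assumes "0 \<le> q" "q \<le> 1"
  shows "(1 - q) ^ N * (1 + real N * q) \<le> 1"
proof -
  have "(1 - q) ^ N * (1 + real N * q) \<le> (1 - q) ^ N * (1 + q) ^ N"
    using assms by (intro mult_left_mono Bernoulli_inequality) auto
  also have "\<dots> = (1 - q\<^sup>2) ^ N"
    by (simp add: power_mult_distrib[symmetric] power2_eq_square algebra_simps)
  also have "\<dots> \<le> 1"
    using assms by (intro power_le_one) (auto simp: power_le_one)
  finally show ?thesis .
qed

text \<open>Scale down a set that is tiny compared with its superlevel set and cover most of the ball
  by few translates of the latter.\<close>

lemma small_set_large_averages:
  fixes B :: "(real^'n) set set"
  assumes hom: "homothecy_invariant B" and B: "\<forall>R\<in>B. open R" "\<forall>R\<in>B. bounded R"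
    and u: "0 < u" and halo: "halo B u = top" and \<epsilon>: "0 < \<epsilon>"
  shows "\<exists>S G. S \<in> lmeasurable \<and> measure lebesgue S \<le> \<epsilon> \<and> G \<in> lmeasurable \<and>
    measure lebesgue (ball 0 1 - G) \<le> \<epsilon> \<and>
    (\<forall>x\<in>G. \<exists>R\<in>B. x \<in> R \<and> diameter R \<le> \<epsilon> \<and> dense_in (1 / u) S R)"
proof -
  let ?b1 = "measure lebesgue (ball 0 1 :: (real^'n) set)"
  let ?b = "2 * measure lebesgue (ball 0 2 :: (real^'n) set)"
  have b: "0 < ?b1" "0 < ?b"
    by (simp_all add: content_ball_pos)
  \<comment> \<open>With \<open>N\<close> at least \<open>M / q\<close>, the uncovered part has
    measure at most \<open>?b1 / M = \<epsilon>\<close>. The constant \<open>c\<close> is chosen so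
    that the total measure of the copies of \<open>A\<close>, bounded below by
    \<open>(M + 1) * ?b / c\<close>, comes out as at most \<epsilon>.\<close>
  define M where "M = ?b1 / \<epsilon>"
  have M: "0 < M"
    using b \<epsilon> by (simp add: M_def)
  define c where "c = (M + 1) * ?b / \<epsilon>"
  have c: "0 < c"
    using b M \<epsilon> by (simp add: c_def)
  obtain A F where AF: "halo_witness B u A F"
    and "ennreal c < ennreal (measure lebesgue (\<Union>F) / measure lebesgue A)"
    using less_halo_iff[OF B(1) u, of "ennreal c"] halo by auto
  then have cAF: "c * measure lebesgue A < measure lebesgue (\<Union>F)"
    using c by (simp add: halo_witness_def ennreal_less_iff field_simps)
  have A: "A \<in> lmeasurable" "0 < measure lebesgue A" and F: "finite F" "F \<subseteq> B"
    and FR: "\<And>R. R \<in> F \<Longrightarrow> dense_in (1 / u) A R"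
    using AF by (auto simp: halo_witness_def)
  have Fl: "\<Union>F \<in> lmeasurable"
    using AF by (rule halo_witness_lmeasurable)
  have "bounded (\<Union>F)"
    using F B(2) by (intro bounded_Union) auto
  then obtain \<rho> where \<rho>: "0 < \<rho>" "\<Union>F \<subseteq> ball 0 \<rho>"
    using bounded_subset_ballD by blast
  \<comment> \<open>The first bound puts the scaled union into the unit ball, the second makes the
    scaled members have diameter at most \<epsilon>. The radius \<rho> exists because the members of
    \<open>B\<close> are bounded.\<close>
  define r where "r = min (1 / \<rho>) (\<epsilon> / (2 * \<rho>))"
  have r: "0 < r" "r * \<rho> \<le> 1" "2 * (r * \<rho>) \<le> \<epsilon>"
    using \<rho> \<epsilon> by (auto simp: r_def field_simps min_def)
  define \<sigma> where "\<sigma> t x = t + r *\<^sub>R x" for t x :: "real^'n"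
  have \<sigma>: "\<sigma> t ` X \<in> lmeasurable" "measure lebesgue (\<sigma> t ` X) = r ^ CARD('n) * measure lebesgue X"
    if "X \<in> lmeasurable" for t X
    using lmeasurable_homothety[OF that r(1), of t] unfolding \<sigma>_def by simp_all
  have small: "\<sigma> t ` \<Union>F \<subseteq> ball t (r * \<rho>)" for t
  proof
    fix y assume "y \<in> \<sigma> t ` \<Union>F"
    then obtain x where x: "x \<in> \<Union>F" "y = t + r *\<^sub>R x"
      by (auto simp: \<sigma>_def)
    with \<rho> have "norm x < \<rho>"
      by auto
    with x r show "y \<in> ball t (r * \<rho>)"
      by (simp add: dist_norm)
  qed
  define H where "H = \<sigma> 0 ` \<Union>F"
  have "open H"
    unfolding H_def \<sigma>_def using r(1) F B(1) by (simp, intro open_scaling) auto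
  moreover have "H \<subseteq> ball 0 1"
    using small[of 0] r(2) subset_ball[of "r * \<rho>" 1 0] unfolding H_def by blast
  ultimately have H: "open H" "H \<subseteq> ball 0 1" "H \<in> lmeasurable"
    using \<sigma>(1)[OF Fl] by (auto simp: H_def)
  have tH: "(+) t ` H = \<sigma> t ` \<Union>F" for t
    by (simp add: H_def \<sigma>_def image_image)
  have rn: "0 < r ^ CARD('n)"
    using r(1) by simp
  have mH: "measure lebesgue H = r ^ CARD('n) * measure lebesgue (\<Union>F)"
    unfolding H_def by (rule \<sigma>(2)[OF Fl])
  have F0: "0 < measure lebesgue (\<Union>F)"
    using cAF c A(2) by (smt (verit) mult_pos_pos)
  have H0: "0 < measure lebesgue H"
    using mH rn F0 by simp
  define q where "q = measure lebesgue H / ?b"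
  have q0: "0 < q"
    using H0 b by (simp add: q_def)
  have "measure lebesgue H \<le> measure lebesgue (ball 0 2 :: (real^'n) set)"
    using H by (intro measure_mono_fmeasurable) (auto intro: less_trans)
  then have "measure lebesgue H \<le> ?b"
    using b by linarith
  then have q1: "q \<le> 1"
    using b by (simp add: q_def field_simps)
  define N where "N = nat \<lceil>M / q\<rceil>"
  have N: "M / q \<le> real N" "real N \<le> M / q + 1"
    using M q0 by (auto simp: N_def)
  obtain T where T: "finite T" "card T \<le> N" and cover:
    "measure lebesgue (ball 0 1 - (\<Union>t\<in>T. (+) t ` H)) \<le> (1 - q) ^ N * ?b1"
    using translates_cover_unit_ball[OF H(1,2), of N] unfolding q_def by blast
  define S where "S = (\<Union>t\<in>T. \<sigma> t ` A)"
  define G where "G = (\<Union>t\<in>T. \<sigma> t ` \<Union>F)"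
  have S: "S \<in> lmeasurable" and G: "G \<in> lmeasurable"
    unfolding S_def G_def using T(1) \<sigma>(1) A(1) Fl by (auto intro!: fmeasurable.finite_UN)
  have "measure lebesgue S \<le> (\<Sum>t\<in>T. measure lebesgue (\<sigma> t ` A))"
    unfolding S_def using T(1) \<sigma>(1)[OF A(1)] by (intro measure_UNION_le) auto
  also have "\<dots> = real (card T) * (r ^ CARD('n) * measure lebesgue A)"
    by (simp add: \<sigma>(2)[OF A(1)])
  also have "\<dots> \<le> (M / q + 1) * (r ^ CARD('n) * measure lebesgue A)"
    using T(2) N(2) rn by (intro mult_right_mono) auto
  also have "\<dots> \<le> (M / q + 1) * (measure lebesgue H / c)"
    using cAF c M q0 rn mH by (intro mult_left_mono) (auto simp: field_simps)
  also have "\<dots> \<le> ((M + 1) / q) * (measure lebesgue H / c)"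
    using q0 q1 c M by (intro mult_right_mono) (auto simp: field_simps)
  \<comment> \<open>The measure of \<open>H\<close> cancels against that in \<open>q\<close>, so the
    bound is independent of the scale \<open>r\<close>; this is why \<open>c\<close> could be fixed
    before \<open>A\<close> and \<open>F\<close>.\<close>
  also have "\<dots> = (M + 1) * ?b / c"
    using H0 b by (simp add: q_def)
  also have "\<dots> = \<epsilon>"
    using b M \<epsilon> by (simp add: c_def)
  finally have S\<epsilon>: "measure lebesgue S \<le> \<epsilon>" .
  have "(1 - q) ^ N * M \<le> (1 - q) ^ N * (1 + real N * q)"
    using N(1) q0 q1 by (intro mult_left_mono) (auto simp: field_simps)
  also have "\<dots> \<le> 1"
    using q0 q1 by (intro one_minus_power_le) auto
  finally have "(1 - q) ^ N * ?b1 \<le> \<epsilon>"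
    using \<epsilon> by (simp add: M_def field_simps)
  with cover have G\<epsilon>: "measure lebesgue (ball 0 1 - G) \<le> \<epsilon>"
    by (simp add: tH G_def)
  have "\<exists>R\<in>B. x \<in> R \<and> diameter R \<le> \<epsilon> \<and> dense_in (1 / u) S R" if "x \<in> G" for x
  proof -
    obtain t R where t: "t \<in> T" "R \<in> F" "x \<in> \<sigma> t ` R"
      using \<open>x \<in> G\<close> unfolding G_def by blast
    have "\<sigma> t ` R \<in> B"
      using hom t(2) F(2) r(1) unfolding homothecy_invariant_def \<sigma>_def by blast
    moreover have "\<sigma> t ` R \<subseteq> ball t (r * \<rho>)"
      using small[of t] t(2) by blast
    then have "diameter (\<sigma> t ` R) \<le> diameter (ball t (r * \<rho>))"
      by (rule diameter_subset) simp
    then have "diameter (\<sigma> t ` R) \<le> \<epsilon>"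
      using r \<epsilon> by (simp split: if_splits)
    \<comment> \<open>A homothety multiplies both measures by the same factor, so
      \<open>\<sigma> t\<close>
      R\<open>inherits the density of\<close>A\<open>in\<close>R\<open>, and\<close>S\<open>contains\<close>\<sigma>
      t \<open>A\<close>.\<close>
    moreover have "dense_in (1 / u) S (\<sigma> t ` R)"
    proof -
      have R: "R \<in> lmeasurable" "1 / u * measure lebesgue R < measure lebesgue (A \<inter> R)"
        using FR[OF t(2)] by (auto simp: dense_in_def)
      have "1 / u * measure lebesgue (\<sigma> t ` R) < measure lebesgue (\<sigma> t ` (A \<inter> R))"
        using R rn mult_strict_left_mono[OF R(2) rn] A(1)
        by (simp add: \<sigma>(2) fmeasurable.Int mult.left_commute)
      also have "\<dots> \<le> measure lebesgue (S \<inter> \<sigma> t ` R)"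
        using t(1) S \<sigma>(1) R(1) A(1)
        by (intro measure_mono_fmeasurable) (auto simp: S_def fmeasurable.Int fmeasurableD)
      finally show ?thesis
        using \<sigma>(1) R(1) by (simp add: dense_in_def)
    qed
    ultimately show ?thesis
      using t(3) by blast
  qed
  with S S\<epsilon> G G\<epsilon> show ?thesis
    by blast
qed

section \<open>Finiteness of the halo function from the density property\<close>

text \<open>The weights \<open>(1 / 2) ^ Suc k\<close> sum to exactly 1 because the exponents start
  at 1.\<close>

lemma measure_UN_half_power_le:
  fixes S :: "nat \<Rightarrow> 'a set"
  assumes S: "\<And>k. S k \<in> fmeasurable M" "\<And>k. measure M (S k) \<le> c * (1 / 2) ^ Suc k"
    and c: "0 \<le> c"
  shows "(\<Union>k. S k) \<in> fmeasurable M" "measure M (\<Union>k. S k) \<le> c"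
proof -
  have "measure M (\<Union>k\<le>n. S k) \<le> c" for n
  proof -
    have "measure M (\<Union>k\<le>n. S k) \<le> (\<Sum>k\<le>n. measure M (S k))"
      using S(1) by (intro measure_UNION_le) auto
    also have "\<dots> \<le> (\<Sum>k\<le>n. c * (1 / 2) ^ Suc k)"
      by (intro sum_mono S(2))
    also have "\<dots> \<le> (\<Sum>k. c * (1 / 2) ^ Suc k)"
      using c power_half_series by (intro sum_le_suminf summable_mult) (auto simp: sums_iff)
    also have "\<dots> = c"
      using sums_mult[OF power_half_series, of c] by (simp only: sums_iff mult_1_right)
    finally show ?thesis .
  qed
  with S(1) show "(\<Union>k. S k) \<in> fmeasurable M" "measure M (\<Union>k. S k) \<le> c"
    by (intro fmeasurable_countable_Union measure_countable_Union_le; blast)+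
qed

text \<open>If the value were infinite, there would be sets \<open>S k\<close> of summable measure
  with large averages around most points of the ball at scales tending to 0. Their union
  \<open>E\<close> then has averages above \<open>1 / u\<close> at arbitrarily small scales at
  points outside \<open>E\<close>, on a set of positive measure.\<close>

lemma halo_finite:
  fixes B :: "(real^'n) set set"
  assumes hom: "homothecy_invariant B" and dens: "density_basis B"
    and bounded: "\<forall>R\<in>B. bounded R" and u: "0 < u"
  shows "halo B u < top"
proof (rule ccontr)
  assume "\<not> halo B u < top"
  then have top: "halo B u = top"
    by (simp add: less_top[symmetric])
  have B: "\<forall>R\<in>B. open R"
    using dens by (simp add: density_basis_def)
  let ?Q = "ball 0 1 :: (real^'n) set"
  \<comment> \<open>\<open>E\<close> and the bad set \<open>Z\<close> each have measure at most a
    third of the ball, so at least a third remains for \<open>X\<close>.\<close>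
  define c where "c = measure lebesgue ?Q / 3"
  have c: "0 < c"
    by (simp add: c_def content_ball_pos)
  have "\<exists>S G. S \<in> lmeasurable \<and> measure lebesgue S \<le> c * (1 / 2) ^ Suc k \<and> G \<in> lmeasurable \<and>
      measure lebesgue (?Q - G) \<le> c * (1 / 2) ^ Suc k \<and>
      (\<forall>x\<in>G. \<exists>R\<in>B. x \<in> R \<and> diameter R \<le> c * (1 / 2) ^ Suc k \<and> dense_in (1 / u) S R)" for k
    using c by (intro small_set_large_averages[OF hom B bounded u top]) simp
  then obtain S G where S: "\<And>k. S k \<in> lmeasurable" "\<And>k. measure lebesgue (S k) \<le> c * (1 / 2) ^ Suc k"
    and G: "\<And>k. G k \<in> lmeasurable" "\<And>k. measure lebesgue (?Q - G k) \<le> c * (1 / 2) ^ Suc k"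
    and R: "\<And>k x. x \<in> G k \<Longrightarrow>
      \<exists>R\<in>B. x \<in> R \<and> diameter R \<le> c * (1 / 2) ^ Suc k \<and> dense_in (1 / u) (S k) R"
    by metis
  define E where "E = (\<Union>k. S k)"
  define Z where "Z = (\<Union>k. ?Q - G k)"
  have E: "E \<in> lmeasurable" "measure lebesgue E \<le> c"
    unfolding E_def using measure_UN_half_power_le[OF S] c by simp_all
  have Z: "Z \<in> lmeasurable" "measure lebesgue Z \<le> c"
    unfolding Z_def using measure_UN_half_power_le[of "\<lambda>k. ?Q - G k", OF _ G(2)] G(1) c
    by (simp_all add: fmeasurable.Diff)
  define X where "X = ?Q - (E \<union> Z)"
  have EZ: "E \<union> Z \<in> lmeasurable" "measure lebesgue (E \<union> Z) \<le> 2 * c"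
    using E Z measure_Un_le[of E lebesgue Z] by auto
  have "measure lebesgue ?Q - measure lebesgue (E \<union> Z) \<le> measure lebesgue X"
    unfolding X_def using EZ by (intro measure_diff_le_measure_setdiff) auto
  then have X: "0 < measure lebesgue X"
    using EZ(2) c unfolding c_def by linarith
  have "AE x in lebesgue. \<forall>R :: nat \<Rightarrow> (real^'n) set.
        (\<forall>k. R k \<in> B \<and> x \<in> R k) \<longrightarrow>
        (\<forall>\<^sub>F k in sequentially. bounded (R k)) \<longrightarrow>
        (\<lambda>k. diameter (R k)) \<longlonglongrightarrow> 0 \<longrightarrow>
        (\<lambda>k. average (R k) (indicator E)) \<longlonglongrightarrow> indicator E x" (is "AE x in lebesgue. ?P x")
    using dens E(1) by (simp add: density_basis_def fmeasurableD)
  then obtain N where N: "{x. \<not> ?P x} \<subseteq> N" "N \<in> null_sets lebesgue"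
    by (auto simp: eventually_ae_filter)
  \<comment> \<open>Positive measure of \<open>X\<close> yields a point of \<open>X\<close> at which
    the density property for \<open>E\<close> holds.\<close>
  have "\<not> X \<subseteq> N"
  proof
    assume "X \<subseteq> N"
    then have "negligible X"
      using N(2) by (metis negligible_iff_null_sets negligible_subset)
    with X show False
      by (simp add: negligible_imp_measure0)
  qed
  then obtain x where x: "x \<in> X" "?P x"
    using N(1) by blast
  then have "x \<in> G k" for k
    by (auto simp: X_def Z_def)
  then have "\<forall>k. \<exists>R\<in>B. x \<in> R \<and> diameter R \<le> c * (1 / 2) ^ Suc k \<and> dense_in (1 / u) (S k) R"
    using R by blast
  then obtain K where K: "\<And>k. K k \<in> B" "\<And>k. x \<in> K k"
    "\<And>k. diameter (K k) \<le> c * (1 / 2) ^ Suc k" "\<And>k. dense_in (1 / u) (S k) (K k)"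
    by metis
  have "(\<lambda>k. (1 / 2 :: real) ^ Suc k) \<longlonglongrightarrow> 0"
    by (intro LIMSEQ_Suc LIMSEQ_power_zero) simp
  then have "(\<lambda>k. c * (1 / 2) ^ Suc k) \<longlonglongrightarrow> 0"
    by (rule tendsto_mult_right_zero)
  moreover have "0 \<le> diameter (K k)" for k
    using K(1) bounded by (intro diameter_ge_0) auto
  ultimately have "(\<lambda>k. diameter (K k)) \<longlonglongrightarrow> 0"
    using K(3)
    by (intro tendsto_sandwich[of "\<lambda>_. 0" "\<lambda>k. diameter (K k)" _ "\<lambda>k. c * (1 / 2) ^ Suc k"])
      (simp_all del: power_Suc)
  then have "(\<lambda>k. average (K k) (indicator E)) \<longlonglongrightarrow> indicator E x"
    using x(2) K(1,2) bounded by simp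
  then have "(\<lambda>k. average (K k) (indicator E)) \<longlonglongrightarrow> 0"
    using x(1) by (simp add: X_def)
  then have "\<forall>\<^sub>F k in sequentially. average (K k) (indicator E) < ennreal (1 / u)"
    using u by (intro order_tendstoD(2)) auto
  then obtain k where k: "average (K k) (indicator E) < ennreal (1 / u)"
    using eventually_happens by force
  \<comment> \<open>The density of \<open>S k\<close> in \<open>K k\<close> passes to the larger set
    \<open>E\<close>, although the limit of the averages is 0 because \<open>x\<close> lies outside
    \<open>E\<close>.\<close>
  have "dense_in (1 / u) E (K k)"
  proof -
    have "measure lebesgue (S k \<inter> K k) \<le> measure lebesgue (E \<inter> K k)"
      using S(1) E(1) K(4)[of k]
      by (intro measure_mono_fmeasurable) (auto simp: E_def dense_in_def fmeasurable.Int fmeasurableD)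
    with K(4)[of k] show ?thesis
      by (simp add: dense_in_def)
  qed
  then have "ennreal (1 / u) < average (K k) (indicator E)"
    using average_gt_iff_dense_in[of "K k" E "1 / u"] B K(1) E(1) u by simp
  with k show False
    by simp
qed

text \<open>Continuity is meant in \<open>ennreal\<close>, where infinite values are allowed; the
  second conjunct turns it into continuity of a finite-valued function when the members of
  \<open>B\<close> are bounded.\<close>

theorem theorem1:
  fixes B :: "(real^'n) set set"
  assumes "homothecy_invariant B"
    and "density_basis B"
  shows "continuous_on {1<..} (halo B) \<and>
         ((\<forall>R\<in>B. bounded R) \<longrightarrow> (\<forall>u>1. halo B u < \<infinity>))"
  using continuous_on_halo[of B] halo_finite[OF assms] assms(2)
  by (simp add: density_basis_def)

end
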